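(* Let $n\ge 2$, $1\le k\le n-1$, $A\in\mathcal M_n(\mathbb C)$, and let $\lambda$ be an eigenvalue of $A$. Let $\delta_1\ge\dots\ge\delta_n$ be the eigenvalues of the Hermitian part $H(A)$. With $V_k$ and $W_k=\Delta_k+Y_k-\lambda I_k$ constructed from $A$ and $\lambda$ as in the context, one has $$|\det W_k|^2\,(\mathrm{Re}(\lambda)-\delta_{k+1})\ \le\ (\sigma_1(V_k))^2\,\lambda_{\max}\big(H(\det W_k\,\mathrm{adj}(W_k^* ))\big),$$ where $\mathrm{adj}(W_k^* )$ is the adjugate of $W_k^*$, $\lambda_{\max}(H(\det W_k\,\mathrm{adj}(W_k^* )))\ge 0$ is the largest eigenvalue of the Hermitian part of $\det W_k\,\mathrm{adj}(W_k^* )$, and $\sigma_1(V_k)$ is the largest singular value of $V_k$.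
   Context: $\mathcal M_{n,k}(\mathbb C)$ is the space of complex $n\times k$ matrices and $\mathcal M_n(\mathbb C)=\mathcal M_{n,n}(\mathbb C)$. For a square complex matrix $B$, $B^*$ is the conjugate transpose, $H(B)=\frac12(B+B^* )$ is the Hermitian part and $S(B)=\frac12(B-B^* )$ the skew-Hermitian part. The adjugate satisfies $\mathrm{adj}(B)B=(\det B)I$; the adjugate of a $1\times1$ matrix is $1$. Let $\mathbf u_1,\dots,\mathbf u_n$ be orthonormal eigenvectors of $H(A)$ corresponding to $\delta_1\ge\dots\ge\delta_n$, and let $U$ be the unitary matrix with columns $\mathbf u_j$, so that $U^*H(A)U=\mathrm{diag}(\delta_1,\dots,\delta_n)$. Put $\Delta_k=\mathrm{diag}(\delta_1,\dots,\delta_k)$. Write the skew-Hermitian matrix $Y=U^*S(A)U$ in block form $$Y=\begin{pmatrix} Y_k & -V_k^*\\ V_k & \tilde Y_k\end{pmatrix},$$ with $Y_k\in\mathcal M_k(\mathbb C)$, $V_k\in\mathcal M_{n-k,k}(\mathbb C)$, $\tilde Y_k\in\mathcal M_{n-k}(\mathbb C)$. For $\lambda\in\mathbb C$, $W_k=\Delta_k+Y_k-\lambda I_k$, i.e. the leading principal $k\times k$ submatrix of $U^*(A-\lambda I_n)U$. *)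

theory Defs
  imports Complex_Main "Jordan_Normal_Form.Schur_Decomposition"
begin

definition hermitian_part :: "complex mat \<Rightarrow> complex mat" where
  "hermitian_part B = (1 / 2) \<cdot>\<^sub>m (B + mat_adjoint B)"

definition skew_hermitian_part :: "complex mat \<Rightarrow> complex mat" where
  "skew_hermitian_part B = (1 / 2) \<cdot>\<^sub>m (B - mat_adjoint B)"

(* Only meant for Hermitian matrices of positive size: there every eigenvalue is real,
   so the set below is the whole (finite, nonempty) spectrum. *)
definition largest_eigenvalue :: "complex mat \<Rightarrow> real" where
  "largest_eigenvalue B = Max {x :: real. eigenvalue B (complex_of_real x)}"

(* The singular values of V are the square roots of the eigenvalues of V^* V. For a wide V
   these include extra zeros, which do not change the largest one. *)
definition largest_singular_value :: "complex mat \<Rightarrow> real" where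
  "largest_singular_value V = sqrt (largest_eigenvalue (mat_adjoint V * V))"

(* The vectors u 0, ..., u (n - 1) form an orthonormal basis of eigenvectors of the n x n matrix B
   for the real values d 0 \<ge> ... \<ge> d (n - 1); so these values are the eigenvalues of B, listed
   with multiplicity in nonincreasing order. Indices start at 0: d j is the (j+1)-st largest. *)
definition ordered_orthonormal_eigenbasis ::
  "nat \<Rightarrow> complex mat \<Rightarrow> (nat \<Rightarrow> real) \<Rightarrow> (nat \<Rightarrow> complex vec) \<Rightarrow> bool" where
  "ordered_orthonormal_eigenbasis n B d u \<longleftrightarrow>
     (\<forall>i<n. \<forall>j<n. i \<le> j \<longrightarrow> d j \<le> d i) \<and>
     (\<forall>j<n. eigenvector B (u j) (complex_of_real (d j))) \<and>
     (\<forall>i<n. \<forall>j<n. u i \<bullet>c u j = (if i = j then 1 else 0))"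

end

theory Submission
  imports Defs "HOL-Analysis.L2_Norm"
begin

text \<open>
  In the coordinates given by \<open>U\<close> the matrix \<open>A - \<lambda>I\<close> has the block form with diagonal blocks \<open>W\<close> and
  \<open>Z\<close> and off-diagonal blocks \<open>-V\<^sup>*\<close> and \<open>V\<close>, where \<open>Z\<close> is the diagonal matrix of
  \<open>\<delta>\<^sub>k\<^sub>+\<^sub>1, \<dots>, \<delta>\<^sub>n\<close> plus a skew-Hermitian matrix minus \<open>\<lambda>I\<close>
  (the formal indices start at 0, so \<open>\<delta>\<^sub>k\<^sub>+\<^sub>1\<close> is \<open>\<delta> k\<close>). An eigenvector of \<open>A\<close> for \<open>\<lambda>\<close>
  becomes a nonzero kernel vector \<open>(a, b)\<close>, that is, \<open>W a = V\<^sup>* b\<close> and \<open>V a = -Z b\<close>.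

  Skew-Hermitian matrices have purely imaginary quadratic forms, so
  \<open>Re \<langle>Z b, b\<rangle> \<le> (\<delta>\<^sub>k\<^sub>+\<^sub>1 - Re \<lambda>) |b|\<^sup>2\<close>; and the two block equations give
  \<open>Re \<langle>W a, a\<rangle> = Re \<langle>b, V a\<rangle> = - Re \<langle>Z b, b\<rangle>\<close>. Hence
  \<open>(Re \<lambda> - \<delta>\<^sub>k\<^sub>+\<^sub>1) |b|\<^sup>2 \<le> Re \<langle>W a, a\<rangle>\<close>.

  The adjugate enters through the identity \<open>adjugate_form\<close>: the quadratic form of
  \<open>det W adj(W\<^sup>*)\<close> at \<open>W a\<close> is \<open>|det W|\<^sup>2 \<langle>W a, a\<rangle>\<close>, since moving \<open>W\<close> across the inner product
  produces \<open>W\<^sup>* adj(W\<^sup>*)\<close>, a scalar matrix. Rayleigh's inequality for the Hermitian part of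
  \<open>det W adj(W\<^sup>*)\<close>, with largest eigenvalue \<open>L\<close>, together with \<open>W a = V\<^sup>* b\<close> now gives
  \<open>|det W|\<^sup>2 (Re \<lambda> - \<delta>\<^sub>k\<^sub>+\<^sub>1) |b|\<^sup>2 \<le> L |V\<^sup>* b|\<^sup>2 \<le> L \<sigma>\<^sub>1(V)\<^sup>2 |b|\<^sup>2\<close>. If \<open>b = 0\<close> then
  \<open>W a = 0\<close> with \<open>a \<noteq> 0\<close>, so \<open>det W = 0\<close> and the bound reduces to \<open>L \<ge> 0\<close>
  (\<open>block_kernel_bound\<close>). The same identity at \<open>W e\<^sub>1\<close> shows \<open>L \<ge> 0\<close>, because
  \<open>Re \<langle>W e\<^sub>1, e\<^sub>1\<rangle> = \<delta>\<^sub>1 - Re \<lambda>\<close> is nonnegative (for singular \<open>W\<close> the matrix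
  \<open>det W adj(W\<^sup>*)\<close> is zero).

  Rayleigh's inequality itself (\<open>re_form_le_largest_eigenvalue\<close>) is obtained directly, with neither
  diagonalisation nor compactness: if the supremum \<open>R\<close> of the form of \<open>H\<close> over unit vectors were not
  an eigenvalue, then \<open>R I - H\<close> would be nonsingular and positive semidefinite, hence bounded below by
  a positive multiple of the identity, and \<open>R\<close> would not be the least upper bound.
\<close>

section \<open>Inner products, adjoints and quadratic forms\<close>

definition sq_len :: "complex vec \<Rightarrow> real" where
  "sq_len x = Re (x \<bullet>c x)"

definition re_form :: "complex mat \<Rightarrow> complex vec \<Rightarrow> real" where
  "re_form M x = Re ((M *\<^sub>v x) \<bullet>c x)"

lemma inner_sum:
  assumes "x \<in> carrier_vec n" "y \<in> carrier_vec n"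
  shows "x \<bullet>c y = (\<Sum>i<n. x $ i * cnj (y $ i))"
  using assms by (auto simp: scalar_prod_def atLeast0LessThan intro!: sum.cong)

lemma inner_commute:
  assumes "(x :: complex vec) \<in> carrier_vec n" "y \<in> carrier_vec n"
  shows "y \<bullet>c x = cnj (x \<bullet>c y)"
  unfolding inner_sum[OF assms] inner_sum[OF assms(2,1)] cnj_sum
  by (rule sum.cong[OF refl]) (simp add: mult.commute)

lemma sq_len_sum:
  assumes "x \<in> carrier_vec n"
  shows "sq_len x = (\<Sum>i<n. (cmod (x $ i))\<^sup>2)"
  unfolding sq_len_def inner_sum[OF assms assms] Re_sum
  by (rule sum.cong[OF refl]) (simp flip: complex_norm_square)

lemma inner_self:
  assumes "x \<in> carrier_vec n"
  shows "x \<bullet>c x = complex_of_real (sq_len x)"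
  unfolding inner_sum[OF assms assms] sq_len_sum[OF assms] of_real_sum
  by (rule sum.cong[OF refl]) (rule complex_norm_square[symmetric])

lemma sq_len_nonneg: "sq_len x \<ge> 0"
  unfolding sq_len_sum[OF carrier_vec_dim_vec] by (simp add: sum_nonneg)

lemma sq_len_zero: "sq_len (0\<^sub>v n) = 0"
  by (simp add: sq_len_sum[of _ n])

lemma sq_len_pos:
  assumes "x \<in> carrier_vec n" "x \<noteq> 0\<^sub>v n"
  shows "sq_len x > 0"
proof -
  have "sq_len x \<noteq> 0"
    using conjugate_square_eq_0_vec[OF assms(1)] assms(2) by (auto simp: inner_self[OF assms(1)])
  then show ?thesis
    using sq_len_nonneg[of x] by simp
qed

lemma sq_len_smult:
  assumes "x \<in> carrier_vec n"
  shows "sq_len (c \<cdot>\<^sub>v x) = (cmod c)\<^sup>2 * sq_len x"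
  using assms by (simp add: sq_len_sum[of _ n] sum_distrib_left norm_mult power_mult_distrib)

lemma cauchy_schwarz_vec:
  assumes "x \<in> carrier_vec n" "y \<in> carrier_vec n"
  shows "(cmod (x \<bullet>c y))\<^sup>2 \<le> sq_len x * sq_len y"
proof -
  have "cmod (x \<bullet>c y) \<le> (\<Sum>i<n. \<bar>cmod (x $ i)\<bar> * \<bar>cmod (y $ i)\<bar>)"
    unfolding inner_sum[OF assms] by (rule order_trans[OF norm_sum]) (simp add: norm_mult)
  also have "\<dots> \<le> L2_set (\<lambda>i. cmod (x $ i)) {..<n} * L2_set (\<lambda>i. cmod (y $ i)) {..<n}"
    by (rule L2_set_mult_ineq)
  also have "\<dots> = sqrt (sq_len x * sq_len y)"
    unfolding L2_set_def sq_len_sum[OF assms(1)] sq_len_sum[OF assms(2)]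
    by (simp add: real_sqrt_mult)
  finally have "(cmod (x \<bullet>c y))\<^sup>2 \<le> (sqrt (sq_len x * sq_len y))\<^sup>2"
    by (rule power_mono) simp
  then show ?thesis
    by (simp add: sq_len_nonneg)
qed

lemma mat_adjoint_dim [simp]:
  "dim_row (mat_adjoint A) = dim_col A" "dim_col (mat_adjoint A) = dim_row A"
  by (auto simp: mat_adjoint_def)

lemma mat_adjoint_carrier [simp]:
  "A \<in> carrier_mat m n \<Longrightarrow> mat_adjoint A \<in> carrier_mat n m"
  by (rule carrier_matI) simp_all

lemma mat_adjoint_index [simp]:
  fixes A :: "complex mat"
  assumes "i < dim_col A" "j < dim_row A"
  shows "mat_adjoint A $$ (i, j) = cnj (A $$ (j, i))"
  using assms by (auto simp: mat_adjoint_def mat_of_rows_index)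

lemma mat_adjoint_adjoint:
  fixes A :: "complex mat"
  shows "mat_adjoint (mat_adjoint A) = A"
  by (rule eq_matI) auto

lemma inner_adjoint:
  fixes A :: "complex mat"
  assumes "A \<in> carrier_mat m n" "x \<in> carrier_vec n" "y \<in> carrier_vec m"
  shows "(A *\<^sub>v x) \<bullet>c y = x \<bullet>c (mat_adjoint A *\<^sub>v y)"
proof -
  have "(A *\<^sub>v x) \<bullet>c y = (\<Sum>i<m. \<Sum>j<n. A $$ (i,j) * x $ j * cnj (y $ i))"
    using assms by (simp add: inner_sum[of _ m] scalar_prod_def sum_distrib_right atLeast0LessThan)
  also have "\<dots> = (\<Sum>j<n. \<Sum>i<m. A $$ (i,j) * x $ j * cnj (y $ i))"
    by (rule sum.swap)
  also have "\<dots> = x \<bullet>c (mat_adjoint A *\<^sub>v y)"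
    using assms
    by (simp add: inner_sum[of _ n] scalar_prod_def sum_distrib_left atLeast0LessThan mult_ac)
  finally show ?thesis .
qed

lemma inner_adjoint':
  fixes A :: "complex mat"
  assumes "A \<in> carrier_mat m n" "x \<in> carrier_vec n" "y \<in> carrier_vec m"
  shows "(mat_adjoint A *\<^sub>v y) \<bullet>c x = y \<bullet>c (A *\<^sub>v x)"
  using inner_adjoint[of "mat_adjoint A" n m y x] assms by (simp add: mat_adjoint_adjoint)

lemma det_mat_adjoint:
  fixes A :: "complex mat"
  assumes "A \<in> carrier_mat n n"
  shows "det (mat_adjoint A) = cnj (det A)"
proof -
  interpret comm_ring_hom cnj by unfold_locales auto
  have "mat_adjoint A = map_mat cnj (transpose_mat A)"
    using assms by (intro eq_matI) auto
  then show ?thesis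
    using assms by (simp add: det_transpose)
qed

text \<open>The constant is the squared Frobenius norm of \<open>B\<close>, increased by one so that it is positive and can
  be divided by.\<close>
lemma sq_len_mult_mat_vec_bound:
  fixes B :: "complex mat"
  assumes B: "B \<in> carrier_mat m n"
  shows "\<exists>C>0. \<forall>x \<in> carrier_vec n. sq_len (B *\<^sub>v x) \<le> C * sq_len x"
proof (intro exI conjI ballI)
  let ?C = "1 + (\<Sum>i<m. sq_len (row B i))"
  have nonneg: "(\<Sum>i<m. sq_len (row B i)) \<ge> 0"
    by (intro sum_nonneg sq_len_nonneg)
  then show "?C > 0" by linarith
  fix x :: "complex vec"
  assume x: "x \<in> carrier_vec n"
  have "sq_len (B *\<^sub>v x) = (\<Sum>i<m. (cmod (row B i \<bullet>c conjugate x))\<^sup>2)"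
    using B by (simp add: sq_len_sum[OF mult_mat_vec_carrier[OF B x]])
  also have "\<dots> \<le> (\<Sum>i<m. sq_len (row B i) * sq_len x)"
  proof (rule sum_mono)
    fix i
    have "row B i \<in> carrier_vec n"
      using B by auto
    moreover have "sq_len (conjugate x) = sq_len x"
      using x by (simp add: sq_len_sum[of _ n])
    ultimately show "(cmod (row B i \<bullet>c conjugate x))\<^sup>2 \<le> sq_len (row B i) * sq_len x"
      using cauchy_schwarz_vec[of "row B i" n "conjugate x"] x by simp
  qed
  also have "\<dots> \<le> ?C * sq_len x"
    using sq_len_nonneg[of x] by (simp add: sum_distrib_right[symmetric] distrib_right)
  finally show "sq_len (B *\<^sub>v x) \<le> ?C * sq_len x" .
qed

lemma re_form_smult_vec:
  assumes "M \<in> carrier_mat n n" "x \<in> carrier_vec n"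
  shows "re_form M (c \<cdot>\<^sub>v x) = (cmod c)\<^sup>2 * re_form M x"
proof -
  have "(M *\<^sub>v (c \<cdot>\<^sub>v x)) \<bullet>c (c \<cdot>\<^sub>v x) = (c * cnj c) * ((M *\<^sub>v x) \<bullet>c x)"
    using assms
    by (simp add: mult_mat_vec inner_sum[of _ n] sum_distrib_left mult_ac)
  then show ?thesis
    unfolding re_form_def complex_norm_square[symmetric] by simp
qed

lemma re_form_add:
  assumes "M \<in> carrier_mat n n" "N \<in> carrier_mat n n" "x \<in> carrier_vec n"
  shows "re_form (M + N) x = re_form M x + re_form N x"
  using assms unfolding re_form_def
  by (simp add: add_mult_distrib_mat_vec[of _ n n] add_scalar_prod_distrib[of _ n])

lemma smult_mat_mult_vec:
  fixes M :: "complex mat"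
  assumes "M \<in> carrier_mat m n" "x \<in> carrier_vec n"
  shows "(c \<cdot>\<^sub>m M) *\<^sub>v x = c \<cdot>\<^sub>v (M *\<^sub>v x)"
  using assms by (intro eq_vecI) auto

lemma mult_mat_zero_vec:
  fixes M :: "complex mat"
  assumes "M \<in> carrier_mat m n"
  shows "M *\<^sub>v 0\<^sub>v n = 0\<^sub>v m"
  using assms by (intro eq_vecI) auto

lemma re_form_smult_real:
  assumes "M \<in> carrier_mat n n" "x \<in> carrier_vec n"
  shows "re_form (complex_of_real c \<cdot>\<^sub>m M) x = c * re_form M x"
  using assms unfolding re_form_def
  by (simp add: smult_mat_mult_vec smult_scalar_prod_distrib[of _ n])

lemma re_form_one:
  assumes "x \<in> carrier_vec n"
  shows "re_form (1\<^sub>m n) x = sq_len x"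
  using assms by (simp add: re_form_def sq_len_def)

lemma re_form_adjoint:
  assumes "M \<in> carrier_mat n n" "x \<in> carrier_vec n"
  shows "re_form (mat_adjoint M) x = re_form M x"
  unfolding re_form_def inner_adjoint'[OF assms(1,2,2)]
  using inner_commute[of x n "M *\<^sub>v x"] assms by simp

lemma hermitian_part_carrier [simp]:
  "B \<in> carrier_mat n n \<Longrightarrow> hermitian_part B \<in> carrier_mat n n"
  by (auto simp: hermitian_part_def)

lemma skew_hermitian_part_carrier [simp]:
  "B \<in> carrier_mat n n \<Longrightarrow> skew_hermitian_part B \<in> carrier_mat n n"
  by (auto simp: skew_hermitian_part_def minus_carrier_mat)

lemma hermitian_part_hermitian:
  assumes "B \<in> carrier_mat n n"
  shows "mat_adjoint (hermitian_part B) = hermitian_part B"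
  using assms by (intro eq_matI) (auto simp: hermitian_part_def)

lemma hermitian_plus_skew_hermitian_part:
  assumes "B \<in> carrier_mat n n"
  shows "hermitian_part B + skew_hermitian_part B = B"
  using assms
  by (intro eq_matI) (auto simp: hermitian_part_def skew_hermitian_part_def field_simps)

text \<open>A matrix and its adjoint have complex conjugate quadratic forms, so only the Hermitian part
  contributes to the real part of the form.\<close>
lemma re_form_hermitian_part:
  assumes "B \<in> carrier_mat n n" "x \<in> carrier_vec n"
  shows "re_form (hermitian_part B) x = re_form B x"
  using re_form_smult_real[of "B + mat_adjoint B" n x "1/2"] re_form_adjoint[OF assms] assms
  by (simp add: hermitian_part_def re_form_add[of _ n])

lemma re_form_skew_hermitian_part:
  assumes "B \<in> carrier_mat n n" "x \<in> carrier_vec n"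
  shows "re_form (skew_hermitian_part B) x = 0"
  using re_form_add[of "hermitian_part B" n "skew_hermitian_part B" x]
    re_form_hermitian_part[OF assms] assms
  by (simp add: hermitian_plus_skew_hermitian_part)

section \<open>The Rayleigh bound for the largest eigenvalue\<close>

text \<open>The adjugate is an inverse up to the factor \<open>det Q\<close>, and it is a bounded map.\<close>
lemma nonsingular_imp_bounded_below:
  fixes Q :: "complex mat"
  assumes Q: "Q \<in> carrier_mat n n" and det: "det Q \<noteq> 0"
  shows "\<exists>C>0. \<forall>x \<in> carrier_vec n. sq_len x \<le> C * sq_len (Q *\<^sub>v x)"
proof -
  obtain C where C: "C > 0" "\<And>y. y \<in> carrier_vec n \<Longrightarrow> sq_len (adj_mat Q *\<^sub>v y) \<le> C * sq_len y"
    using sq_len_mult_mat_vec_bound[OF adj_mat(1)[OF Q]] by blast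
  have d: "(cmod (det Q))\<^sup>2 > 0"
    using det by simp
  have "sq_len x \<le> C / (cmod (det Q))\<^sup>2 * sq_len (Q *\<^sub>v x)" if x: "x \<in> carrier_vec n" for x
  proof -
    have "adj_mat Q *\<^sub>v (Q *\<^sub>v x) = (adj_mat Q * Q) *\<^sub>v x"
      using Q x adj_mat(1)[OF Q] by (simp add: assoc_mult_mat_vec[of _ n n])
    also have "\<dots> = det Q \<cdot>\<^sub>v x"
      using x by (simp add: adj_mat(3)[OF Q] smult_mat_mult_vec[of _ n n])
    finally have "(cmod (det Q))\<^sup>2 * sq_len x = sq_len (adj_mat Q *\<^sub>v (Q *\<^sub>v x))"
      using x by (simp add: sq_len_smult)
    also have "\<dots> \<le> C * sq_len (Q *\<^sub>v x)"
      by (rule C(2)) (use Q x in simp)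
    finally show ?thesis
      using d by (simp add: field_simps)
  qed
  moreover have "C / (cmod (det Q))\<^sup>2 > 0"
    using C(1) d by simp
  ultimately show ?thesis
    by blast
qed

text \<open>For a positive semidefinite Hermitian \<open>Q\<close> the form controls \<open>|Q x|\<^sup>2\<close>: evaluating it at
  \<open>x - t Q x\<close> for a small real \<open>t > 0\<close> gives
  \<open>0 \<le> \<langle>Q x, x\<rangle> - 2 t |Q x|\<^sup>2 + t\<^sup>2 \<langle>Q Q x, Q x\<rangle>\<close>, and the last term is at most \<open>t |Q x|\<^sup>2\<close>.
  For nonsingular \<open>Q\<close> the quantity \<open>|Q x|\<^sup>2\<close> in turn controls \<open>|x|\<^sup>2\<close>.\<close>
lemma nonsingular_psd_imp_coercive:
  assumes Q: "Q \<in> carrier_mat n n" and herm: "mat_adjoint Q = Q" and det: "det Q \<noteq> 0"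
    and psd: "\<And>x. x \<in> carrier_vec n \<Longrightarrow> re_form Q x \<ge> 0"
  shows "\<exists>\<epsilon>>0. \<forall>x \<in> carrier_vec n. \<epsilon> * sq_len x \<le> re_form Q x"
proof -
  obtain C where C: "C > 0" "\<And>x. x \<in> carrier_vec n \<Longrightarrow> sq_len x \<le> C * sq_len (Q *\<^sub>v x)"
    using nonsingular_imp_bounded_below[OF Q det] by blast
  obtain K where K: "K > 0" "\<And>x. x \<in> carrier_vec n \<Longrightarrow> sq_len (Q *\<^sub>v x) \<le> K * sq_len x"
    using sq_len_mult_mat_vec_bound[OF Q] by blast
  \<comment> \<open>\<open>K\<close> bounds \<open>|Q x|\<^sup>2 / |x|\<^sup>2\<close>, so the norm of \<open>Q\<close> is at most \<open>sqrt K \<le> 1 + K\<close>.\<close>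
  define t where "t = 1 / (1 + K)"
  have "t > 0" and tK: "t * (1 + K) = 1"
    using K(1) by (auto simp: t_def)
  have "t * sq_len (Q *\<^sub>v x) \<le> re_form Q x" if x: "x \<in> carrier_vec n" for x
  proof -
    define y where "y = Q *\<^sub>v x"
    define z where "z = Q *\<^sub>v y"
    have carr: "y \<in> carrier_vec n" "z \<in> carrier_vec n"
      using Q x by (auto simp: y_def z_def)
    let ?w = "x + complex_of_real (- t) \<cdot>\<^sub>v y"
    have "Q *\<^sub>v ?w = y + complex_of_real (- t) \<cdot>\<^sub>v z"
      using Q x carr unfolding y_def z_def
      by (simp add: mult_add_distrib_mat_vec[of _ n n] mult_mat_vec[of _ n n])
    then have "re_form Q ?w = Re ((y + complex_of_real (- t) \<cdot>\<^sub>v z) \<bullet>c ?w)"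
      by (simp add: re_form_def)
    also have "(y + complex_of_real (- t) \<cdot>\<^sub>v z) \<bullet>c ?w =
        y \<bullet>c x - t * (y \<bullet>c y) - t * (z \<bullet>c x) + t * t * (z \<bullet>c y)"
      using x carr
      by (simp add: inner_sum[of _ n] algebra_simps sum.distrib sum_subtractf sum_distrib_left
          sum_negf)
    also have "z \<bullet>c x = y \<bullet>c y"
      using inner_adjoint[OF Q carr(1) x] herm by (simp add: y_def z_def)
    finally have "re_form Q ?w = re_form Q x - 2 * t * sq_len y + t * t * Re (z \<bullet>c y)"
      by (simp add: re_form_def sq_len_def y_def)
    moreover have "Re (z \<bullet>c y) \<le> (1 + K) * sq_len y"
    proof -
      have "Re (z \<bullet>c y) \<le> cmod (z \<bullet>c y)"
        by (rule complex_Re_le_cmod)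
      also have "\<dots> \<le> sqrt (sq_len z * sq_len y)"
        by (rule real_le_rsqrt) (rule cauchy_schwarz_vec[OF carr(2,1)])
      also have "\<dots> \<le> sqrt (((1 + K) * sq_len y)\<^sup>2)"
      proof (rule real_sqrt_le_mono)
        have "sq_len z * sq_len y \<le> (K * sq_len y) * sq_len y"
          unfolding z_def by (intro mult_right_mono K(2) carr sq_len_nonneg)
        also have "\<dots> = K * (sq_len y)\<^sup>2"
          by (simp add: power2_eq_square)
        also have "\<dots> \<le> (1 + K)\<^sup>2 * (sq_len y)\<^sup>2"
          using K(1) by (intro mult_right_mono) (auto simp: power2_eq_square algebra_simps)
        finally show "sq_len z * sq_len y \<le> ((1 + K) * sq_len y)\<^sup>2"
          by (simp add: power_mult_distrib)
      qed
      finally show ?thesis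
        using K(1) sq_len_nonneg[of y] by simp
    qed
    then have "t * t * Re (z \<bullet>c y) \<le> t * t * ((1 + K) * sq_len y)"
      using \<open>t > 0\<close> by (intro mult_left_mono) auto
    moreover have "t * t * ((1 + K) * sq_len y) = t * sq_len y"
      using tK by (metis mult.assoc mult.commute mult.left_neutral)
    moreover have "re_form Q ?w \<ge> 0"
      by (rule psd) (use x carr in simp)
    ultimately have "t * sq_len y \<le> re_form Q x"
      by linarith
    then show ?thesis
      by (simp add: y_def)
  qed
  moreover have "t / C * sq_len x \<le> t * sq_len (Q *\<^sub>v x)" if "x \<in> carrier_vec n" for x
    using C(2)[OF that] C(1) \<open>t > 0\<close> by (simp add: field_simps)
  ultimately have "\<forall>x \<in> carrier_vec n. t / C * sq_len x \<le> re_form Q x"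
    using order_trans by blast
  moreover have "t / C > 0"
    using C(1) \<open>t > 0\<close> by simp
  ultimately show ?thesis
    by blast
qed

text \<open>The maximum is over a finite set, because eigenvalues are roots of the nonzero characteristic
  polynomial.\<close>
lemma real_eigenvalue_le_largest:
  assumes H: "H \<in> carrier_mat n n" and ev: "eigenvalue H (complex_of_real r)"
  shows "r \<le> largest_eigenvalue H"
proof -
  have "char_poly H \<noteq> 0"
    using degree_monic_char_poly[OF H] by auto
  then have "finite {z. poly (char_poly H) z = 0}"
    by (rule poly_roots_finite)
  then have "finite (complex_of_real -` {z. poly (char_poly H) z = 0})"
    by (rule finite_vimageI) (auto intro: injI)
  then have "finite {x::real. eigenvalue H (complex_of_real x)}"
    by (simp add: eigenvalue_root_char_poly[OF H] vimage_def)
  then show ?thesis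
    unfolding largest_eigenvalue_def using ev by (intro Max_ge) auto
qed

text \<open>Rayleigh's inequality. The supremum \<open>R\<close> of the form over unit vectors bounds the form by
  homogeneity. It is an eigenvalue: otherwise \<open>Q = R I - H\<close> would be nonsingular and positive
  semidefinite, hence coercive with some constant \<open>\<epsilon> > 0\<close>, and \<open>R - \<epsilon>\<close> would be a smaller upper bound.\<close>
lemma re_form_le_largest_eigenvalue:
  assumes H: "H \<in> carrier_mat n n" and herm: "mat_adjoint H = H" and x: "x \<in> carrier_vec n"
  shows "re_form H x \<le> largest_eigenvalue H * sq_len x"
proof (cases "x = 0\<^sub>v n")
  case True
  then show ?thesis
    using H by (simp add: re_form_def sq_len_zero)
next
  case False
  define S where "S = {y \<in> carrier_vec n. sq_len y = 1}"
  define R where "R = Sup (re_form H ` S)"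
  have normalise: "complex_of_real (1 / sqrt (sq_len y)) \<cdot>\<^sub>v y \<in> S"
    and scaled: "re_form H (complex_of_real (1 / sqrt (sq_len y)) \<cdot>\<^sub>v y) = re_form H y / sq_len y"
    if "y \<in> carrier_vec n" "y \<noteq> 0\<^sub>v n" for y
  proof -
    have c: "(cmod (complex_of_real (1 / sqrt (sq_len y))))\<^sup>2 = 1 / sq_len y"
      using sq_len_nonneg[of y] by (simp add: norm_divide power_divide)
    show "complex_of_real (1 / sqrt (sq_len y)) \<cdot>\<^sub>v y \<in> S"
      using that sq_len_pos[OF that] unfolding S_def mem_Collect_eq sq_len_smult[OF that(1)] c by simp
    show "re_form H (complex_of_real (1 / sqrt (sq_len y)) \<cdot>\<^sub>v y) = re_form H y / sq_len y"
      unfolding re_form_smult_vec[OF H that(1)] c by simp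
  qed
  have nonempty: "re_form H ` S \<noteq> {}"
    using normalise[OF x False] by blast
  have bdd: "bdd_above (re_form H ` S)"
  proof -
    obtain K where K: "\<And>y. y \<in> carrier_vec n \<Longrightarrow> sq_len (H *\<^sub>v y) \<le> K * sq_len y"
      using sq_len_mult_mat_vec_bound[OF H] by blast
    have "re_form H y \<le> sqrt K" if "y \<in> S" for y
    proof -
      have y: "y \<in> carrier_vec n" "sq_len y = 1"
        using that by (auto simp: S_def)
      have "re_form H y \<le> cmod ((H *\<^sub>v y) \<bullet>c y)"
        unfolding re_form_def by (rule complex_Re_le_cmod)
      also have "\<dots> \<le> sqrt (sq_len (H *\<^sub>v y) * sq_len y)"
        by (rule real_le_rsqrt, rule cauchy_schwarz_vec[of _ n]) (use H y in auto)
      also have "\<dots> \<le> sqrt K"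
        using K[OF y(1)] y(2) by simp
      finally show ?thesis .
    qed
    then show ?thesis
      by (intro bdd_aboveI2)
  qed
  have upper: "re_form H y \<le> R * sq_len y" if y: "y \<in> carrier_vec n" for y
  proof (cases "y = 0\<^sub>v n")
    case True
    then show ?thesis
      using H by (simp add: re_form_def sq_len_zero)
  next
    case False
    have "re_form H y / sq_len y \<le> R"
      using cSup_upper[OF imageI[OF normalise[OF y False]] bdd] scaled[OF y False]
      by (simp add: R_def)
    then show ?thesis
      using sq_len_pos[OF y False] by (simp add: field_simps)
  qed
  define Q where "Q = complex_of_real R \<cdot>\<^sub>m 1\<^sub>m n + complex_of_real (-1) \<cdot>\<^sub>m H"
  have Q: "Q \<in> carrier_mat n n"
    using H by (simp add: Q_def)
  have form_Q: "re_form Q y = R * sq_len y - re_form H y" if "y \<in> carrier_vec n" for y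
    using H that unfolding Q_def
    by (subst re_form_add[of _ n]) (auto simp: re_form_smult_real[of _ n] re_form_one simp del: of_real_minus)
  have herm_Q: "mat_adjoint Q = Q"
  proof (rule eq_matI)
    fix i j assume "i < dim_row Q" "j < dim_col Q"
    then have ij: "i < n" "j < n"
      using Q by auto
    have "cnj (H $$ (j, i)) = H $$ (i, j)"
      using mat_adjoint_index[of i H j] H ij herm by simp
    then show "mat_adjoint Q $$ (i, j) = Q $$ (i, j)"
      using H ij by (simp add: Q_def)
  qed (use Q in auto)
  have "det Q = 0"
  proof (rule ccontr)
    assume "det Q \<noteq> 0"
    moreover have "re_form Q y \<ge> 0" if "y \<in> carrier_vec n" for y
      using upper[OF that] form_Q[OF that] by simp
    ultimately obtain \<epsilon> where \<epsilon>: "\<epsilon> > 0"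
      "\<And>y. y \<in> carrier_vec n \<Longrightarrow> \<epsilon> * sq_len y \<le> re_form Q y"
      using nonsingular_psd_imp_coercive[OF Q herm_Q] by blast
    have "re_form H y \<le> R - \<epsilon>" if "y \<in> S" for y
      using \<epsilon>(2)[of y] form_Q[of y] that by (simp add: S_def)
    then have "R \<le> R - \<epsilon>"
      unfolding R_def using nonempty by (intro cSup_least) auto
    then show False
      using \<epsilon>(1) by simp
  qed
  then obtain v where v: "v \<in> carrier_vec n" "v \<noteq> 0\<^sub>v n" "Q *\<^sub>v v = 0\<^sub>v n"
    using det_0_iff_vec_prod_zero[OF Q] by blast
  have "H *\<^sub>v v = complex_of_real R \<cdot>\<^sub>v v"
  proof (rule eq_vecI)
    fix i assume "i < dim_vec (complex_of_real R \<cdot>\<^sub>v v)"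
    then have i: "i < n"
      using v by simp
    have "Q *\<^sub>v v = complex_of_real R \<cdot>\<^sub>v v + complex_of_real (-1) \<cdot>\<^sub>v (H *\<^sub>v v)"
      using H v(1) unfolding Q_def
      by (subst add_mult_distrib_mat_vec[of _ n n]) (auto simp: smult_mat_mult_vec[of _ n n])
    then have "(complex_of_real R \<cdot>\<^sub>v v + complex_of_real (-1) \<cdot>\<^sub>v (H *\<^sub>v v)) $ i = 0"
      using v(3) i by (metis index_zero_vec(1))
    then show "(H *\<^sub>v v) $ i = (complex_of_real R \<cdot>\<^sub>v v) $ i"
      using H v(1) i by simp
  qed (use H v in auto)
  then have "eigenvalue H (complex_of_real R)"
    using H v unfolding eigenvalue_def eigenvector_def by auto
  then have "R \<le> largest_eigenvalue H"
    by (rule real_eigenvalue_le_largest[OF H])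
  then show ?thesis
    using upper[OF x] sq_len_nonneg[of x] by (meson mult_right_mono order_trans)
qed

lemma gram_form:
  assumes "V \<in> carrier_mat m k" "x \<in> carrier_vec k"
  shows "re_form (mat_adjoint V * V) x = sq_len (V *\<^sub>v x)"
proof -
  have "(mat_adjoint V * V) *\<^sub>v x = mat_adjoint V *\<^sub>v (V *\<^sub>v x)"
    using assms by (simp add: assoc_mult_mat_vec[of _ k m _ k])
  then show ?thesis
    using inner_adjoint'[OF assms, of "V *\<^sub>v x"] assms by (simp add: re_form_def sq_len_def)
qed

text \<open>Rayleigh's inequality for \<open>V\<^sup>* V\<close>.\<close>
lemma sq_len_mult_le_singular_value:
  assumes V: "V \<in> carrier_mat m k" and x: "x \<in> carrier_vec k"
  shows "sq_len (V *\<^sub>v x) \<le> (largest_singular_value V)\<^sup>2 * sq_len x"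
proof -
  let ?l = "largest_eigenvalue (mat_adjoint V * V)"
  have "mat_adjoint V * V \<in> carrier_mat k k"
    using V by (simp add: mult_carrier_mat[of _ k m])
  moreover have "mat_adjoint (mat_adjoint V * V) = mat_adjoint V * V"
    using V by (intro eq_matI) (auto simp: scalar_prod_def mult.commute)
  ultimately have "sq_len (V *\<^sub>v x) \<le> ?l * sq_len x"
    using re_form_le_largest_eigenvalue[of "mat_adjoint V * V" k x] gram_form[OF V x] x by simp
  also have "\<dots> \<le> (largest_singular_value V)\<^sup>2 * sq_len x"
  proof (rule mult_right_mono)
    \<comment> \<open>The square root is extended to an odd function on the reals.\<close>
    have "(sqrt ?l)\<^sup>2 = \<bar>?l\<bar>"
      using real_sqrt_abs[of "sqrt ?l"] by (metis real_sqrt_abs real_sqrt_power)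
    then show "?l \<le> (largest_singular_value V)\<^sup>2"
      by (simp add: largest_singular_value_def)
  qed (rule sq_len_nonneg)
  finally show ?thesis .
qed

text \<open>The bound for \<open>V\<close> passes to \<open>V\<^sup>*\<close> by duality: with \<open>c = V\<^sup>* y\<close> one has
  \<open>|c|\<^sup>2 = \<langle>V c, y\<rangle> \<le> |V c| |y|\<close>, and one factor \<open>|c|\<close> cancels.\<close>
lemma sq_len_adjoint_mult_le_singular_value:
  assumes V: "V \<in> carrier_mat m k" and y: "y \<in> carrier_vec m"
  shows "sq_len (mat_adjoint V *\<^sub>v y) \<le> (largest_singular_value V)\<^sup>2 * sq_len y"
proof -
  define c where "c = mat_adjoint V *\<^sub>v y"
  let ?s = "(largest_singular_value V)\<^sup>2"
  have c: "c \<in> carrier_vec k" "V *\<^sub>v c \<in> carrier_vec m"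
    unfolding c_def by (rule mult_mat_vec_carrier[OF mat_adjoint_carrier[OF V] y])
      (intro mult_mat_vec_carrier[OF V] mult_mat_vec_carrier[OF mat_adjoint_carrier[OF V] y])
  have "complex_of_real (sq_len c) = (V *\<^sub>v c) \<bullet>c y"
    using inner_adjoint[OF V c(1) y] inner_self[OF c(1)] by (simp add: c_def)
  then have "(sq_len c)\<^sup>2 \<le> sq_len (V *\<^sub>v c) * sq_len y"
    using cauchy_schwarz_vec[OF c(2) y] by (metis norm_of_real power2_abs)
  also have "\<dots> \<le> (?s * sq_len c) * sq_len y"
    by (intro mult_right_mono sq_len_mult_le_singular_value[OF V c(1)] sq_len_nonneg)
  finally have *: "sq_len c * sq_len c \<le> sq_len c * (?s * sq_len y)"
    by (simp add: power2_eq_square mult_ac)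
  show ?thesis
  proof (cases "sq_len c = 0")
    case True
    then show ?thesis
      by (simp add: c_def[symmetric] sq_len_nonneg)
  next
    case False
    then show ?thesis
      using * sq_len_nonneg[of c] by (simp add: c_def[symmetric])
  qed
qed

section \<open>The adjugate form\<close>

text \<open>Moving \<open>W\<close> to the other side of the inner product turns \<open>\<langle>adj(W\<^sup>*) c, W a\<rangle>\<close> into
  \<open>\<langle>W\<^sup>* adj(W\<^sup>*) c, a\<rangle>\<close>, and \<open>W\<^sup>* adj(W\<^sup>*)\<close> is the conjugate of \<open>det W\<close> times the identity. For
  nonsingular \<open>W\<close> this says that \<open>|det W|\<^sup>2\<close> times the form of the inverse of \<open>W\<^sup>*\<close> at \<open>W a\<close> equals
  \<open>|det W|\<^sup>2\<close> times the form of \<open>W\<close> at \<open>a\<close>; the identity persists for singular \<open>W\<close>.\<close>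
lemma adjugate_form:
  fixes W :: "complex mat"
  assumes W: "W \<in> carrier_mat k k" and a: "a \<in> carrier_vec k"
  shows "re_form (det W \<cdot>\<^sub>m adj_mat (mat_adjoint W)) (W *\<^sub>v a) = (cmod (det W))\<^sup>2 * re_form W a"
proof -
  let ?B = "adj_mat (mat_adjoint W)"
  define c where "c = W *\<^sub>v a"
  have W': "mat_adjoint W \<in> carrier_mat k k"
    using W by simp
  note B = adj_mat[OF W']
  have c: "c \<in> carrier_vec k" "?B *\<^sub>v c \<in> carrier_vec k"
    using W a B(1) by (auto simp: c_def)
  have "(?B *\<^sub>v c) \<bullet>c (W *\<^sub>v a) = (mat_adjoint W *\<^sub>v (?B *\<^sub>v c)) \<bullet>c a"
    by (rule inner_adjoint'[OF W a c(2), symmetric])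
  also have "mat_adjoint W *\<^sub>v (?B *\<^sub>v c) = (mat_adjoint W * ?B) *\<^sub>v c"
    using assoc_mult_mat_vec[OF W' B(1) c(1)] by simp
  also have "\<dots> = cnj (det W) \<cdot>\<^sub>v c"
    using c(1) by (simp add: B(2) det_mat_adjoint[OF W] smult_mat_mult_vec[of _ k k])
  also have "(cnj (det W) \<cdot>\<^sub>v c) \<bullet>c a = cnj (det W) * (c \<bullet>c a)"
    using c(1) a by (simp add: smult_scalar_prod_distrib[of _ k])
  finally have "(?B *\<^sub>v c) \<bullet>c c = cnj (det W) * (c \<bullet>c a)"
    by (simp add: c_def)
  then have "((det W \<cdot>\<^sub>m ?B) *\<^sub>v c) \<bullet>c c = (det W * cnj (det W)) * (c \<bullet>c a)"
    using c B(1)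
    by (simp add: smult_mat_mult_vec[of _ k k] smult_scalar_prod_distrib[of _ k] mult_ac)
  then show ?thesis
    unfolding re_form_def c_def complex_norm_square[symmetric] by simp
qed

lemma adjugate_form_le_largest_eigenvalue:
  assumes W: "W \<in> carrier_mat k k" and a: "a \<in> carrier_vec k"
  shows "(cmod (det W))\<^sup>2 * re_form W a
    \<le> largest_eigenvalue (hermitian_part (det W \<cdot>\<^sub>m adj_mat (mat_adjoint W))) * sq_len (W *\<^sub>v a)"
proof -
  let ?B = "det W \<cdot>\<^sub>m adj_mat (mat_adjoint W)"
  have B: "?B \<in> carrier_mat k k"
    using adj_mat(1)[OF mat_adjoint_carrier[OF W]] by simp
  have c: "W *\<^sub>v a \<in> carrier_vec k"
    using W a by (rule mult_mat_vec_carrier)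
  have "re_form (hermitian_part ?B) (W *\<^sub>v a)
      \<le> largest_eigenvalue (hermitian_part ?B) * sq_len (W *\<^sub>v a)"
    by (rule re_form_le_largest_eigenvalue[OF hermitian_part_carrier[OF B]
          hermitian_part_hermitian[OF B] c])
  then show ?thesis
    by (simp only: re_form_hermitian_part[OF B c] adjugate_form[OF W a])
qed

text \<open>One vector \<open>a \<noteq> 0\<close> at which the form of \<open>W\<close> is nonnegative suffices: for nonsingular \<open>W\<close> Rayleigh's
  inequality at \<open>W a \<noteq> 0\<close> decides the sign, and for singular \<open>W\<close> the matrix
  \<open>det W adj(W\<^sup>*)\<close> is zero.\<close>
lemma largest_eigenvalue_adjugate_nonneg:
  assumes W: "W \<in> carrier_mat k k" and a: "a \<in> carrier_vec k" "a \<noteq> 0\<^sub>v k"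
    and nonneg: "re_form W a \<ge> 0"
  shows "largest_eigenvalue (hermitian_part (det W \<cdot>\<^sub>m adj_mat (mat_adjoint W))) \<ge> 0"
    (is "?L \<ge> 0")
proof (cases "det W = 0")
  case True
  let ?B = "det W \<cdot>\<^sub>m adj_mat (mat_adjoint W)"
  have B: "?B \<in> carrier_mat k k"
    using adj_mat(1)[OF mat_adjoint_carrier[OF W]] by simp
  have "re_form ?B a = 0"
    using re_form_smult_real[OF adj_mat(1)[OF mat_adjoint_carrier[OF W]] a(1), of 0] True by simp
  then have "0 \<le> ?L * sq_len a"
    using re_form_le_largest_eigenvalue[OF hermitian_part_carrier[OF B]
          hermitian_part_hermitian[OF B] a(1)]
    by (simp only: re_form_hermitian_part[OF B a(1)])
  then show ?thesis
    using sq_len_pos[OF a] by (simp add: zero_le_mult_iff)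
next
  case False
  then have "W *\<^sub>v a \<noteq> 0\<^sub>v k"
    using det_0_iff_vec_prod_zero[OF W] a by blast
  then have "sq_len (W *\<^sub>v a) > 0"
    using W a(1) by (intro sq_len_pos[of _ k] mult_mat_vec_carrier)
  moreover have "0 \<le> ?L * sq_len (W *\<^sub>v a)"
    using adjugate_form_le_largest_eigenvalue[OF W a(1)] nonneg
    by (meson mult_nonneg_nonneg order_trans zero_le_power2)
  ultimately show ?thesis
    by (simp add: zero_le_mult_iff)
qed

text \<open>A kernel vector \<open>(a, b)\<close> of the matrix with rows \<open>(W, -V\<^sup>*)\<close> and \<open>(V, Z)\<close> transfers an upper bound on
  the form of the block \<open>Z\<close> at \<open>b\<close> to a lower bound on the form of \<open>W\<close> at \<open>a\<close>, because the
  off-diagonal blocks are negative adjoints of each other. The adjugate identity then brings in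
  \<open>W a = V\<^sup>* b\<close>, whose length is controlled by \<open>\<sigma>\<^sub>1(V) |b|\<close>; the factor \<open>|b|\<^sup>2\<close> cancels unless \<open>b = 0\<close>,
  in which case \<open>a\<close> is a nonzero kernel vector of \<open>W\<close>.\<close>
lemma block_kernel_bound:
  assumes W: "W \<in> carrier_mat k k" and V: "V \<in> carrier_mat m k" and Z: "Z \<in> carrier_mat m m"
    and a: "a \<in> carrier_vec k" and b: "b \<in> carrier_vec m"
    and nonzero: "a \<noteq> 0\<^sub>v k \<or> b \<noteq> 0\<^sub>v m"
    and top: "W *\<^sub>v a = mat_adjoint V *\<^sub>v b"
    and bottom: "V *\<^sub>v a + Z *\<^sub>v b = 0\<^sub>v m"
    and Z_bound: "re_form Z b \<le> - \<rho> * sq_len b"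
    and L: "L = largest_eigenvalue (hermitian_part (det W \<cdot>\<^sub>m adj_mat (mat_adjoint W)))"
    and L_nonneg: "L \<ge> 0"
  shows "(cmod (det W))\<^sup>2 * \<rho> \<le> (largest_singular_value V)\<^sup>2 * L"
proof (cases "b = 0\<^sub>v m")
  case True
  then have "W *\<^sub>v a = 0\<^sub>v k"
    using top mult_mat_zero_vec[OF mat_adjoint_carrier[OF V]] by simp
  then have "det W = 0"
    using det_0_iff_vec_prod_zero[OF W] a nonzero True by blast
  then show ?thesis
    using L_nonneg by simp
next
  case False
  have Va: "V *\<^sub>v a \<in> carrier_vec m" and Zb: "Z *\<^sub>v b \<in> carrier_vec m"
    using V Z a b by (auto intro: mult_mat_vec_carrier)
  have "re_form W a = Re (b \<bullet>c (V *\<^sub>v a))"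
    unfolding re_form_def top inner_adjoint'[OF V a b] ..
  also have "\<dots> = Re ((V *\<^sub>v a) \<bullet>c b)"
    using inner_commute[OF Va b] by simp
  also have "\<dots> = - re_form Z b"
  proof -
    have "(V *\<^sub>v a) \<bullet>c b + (Z *\<^sub>v b) \<bullet>c b = (V *\<^sub>v a + Z *\<^sub>v b) \<bullet>c b"
      using Va Zb b by (simp add: add_scalar_prod_distrib[of _ m])
    also have "\<dots> = 0"
      using b by (simp add: bottom)
    finally show ?thesis
      unfolding re_form_def by (simp add: complex_eq_iff)
  qed
  finally have "\<rho> * sq_len b \<le> re_form W a"
    using Z_bound by simp
  then have "(cmod (det W))\<^sup>2 * (\<rho> * sq_len b) \<le> (cmod (det W))\<^sup>2 * re_form W a"
    by (rule mult_left_mono) simp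
  also have "\<dots> \<le> L * sq_len (mat_adjoint V *\<^sub>v b)"
    using adjugate_form_le_largest_eigenvalue[OF W a] by (simp only: L top)
  also have "\<dots> \<le> L * ((largest_singular_value V)\<^sup>2 * sq_len b)"
    using L_nonneg by (intro mult_left_mono sq_len_adjoint_mult_le_singular_value[OF V b])
  finally have "((cmod (det W))\<^sup>2 * \<rho>) * sq_len b \<le> ((largest_singular_value V)\<^sup>2 * L) * sq_len b"
    by (simp add: mult_ac)
  then show ?thesis
    using sq_len_pos[OF b False] by simp
qed

section \<open>Coordinates in an eigenbasis of the Hermitian part\<close>

lemma re_form_congruence:
  assumes "M \<in> carrier_mat n n" "P \<in> carrier_mat n m" "y \<in> carrier_vec m"
  shows "re_form (mat_adjoint P * M * P) y = re_form M (P *\<^sub>v y)"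
proof -
  have Py: "P *\<^sub>v y \<in> carrier_vec n" "M *\<^sub>v (P *\<^sub>v y) \<in> carrier_vec n"
    using assms by (auto intro: mult_mat_vec_carrier)
  have "(mat_adjoint P * M * P) *\<^sub>v y = (mat_adjoint P * M) *\<^sub>v (P *\<^sub>v y)"
    by (rule assoc_mult_mat_vec[of _ m n _ m]) (use assms in auto)
  also have "\<dots> = mat_adjoint P *\<^sub>v (M *\<^sub>v (P *\<^sub>v y))"
    by (rule assoc_mult_mat_vec[of _ m n _ n]) (use assms Py in auto)
  finally show ?thesis
    using inner_adjoint'[OF assms(2,3) Py(2)] by (simp add: re_form_def)
qed

lemma re_form_minus_smult_one:
  assumes "M \<in> carrier_mat n n" "x \<in> carrier_vec n"
  shows "re_form (M - c \<cdot>\<^sub>m 1\<^sub>m n) x = re_form M x - Re c * sq_len x"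
proof -
  have "(M - c \<cdot>\<^sub>m 1\<^sub>m n) *\<^sub>v x = M *\<^sub>v x - c \<cdot>\<^sub>v x"
    using assms
    by (simp add: minus_mult_distrib_mat_vec[of _ n n] smult_mat_mult_vec[of _ n n])
  moreover have "(M *\<^sub>v x - c \<cdot>\<^sub>v x) \<bullet>c x = (M *\<^sub>v x) \<bullet>c x - c * (x \<bullet>c x)"
    using assms
    by (simp add: minus_scalar_prod_distrib[of _ n] smult_scalar_prod_distrib[of _ n])
  ultimately show ?thesis
    by (simp add: re_form_def inner_self[OF assms(2)])
qed

lemma re_form_mat_diag:
  assumes "x \<in> carrier_vec n"
  shows "re_form (mat_diag n (\<lambda>j. complex_of_real (f j))) x = (\<Sum>i<n. f i * (cmod (x $ i))\<^sup>2)"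
proof -
  have entry: "(mat_diag n (\<lambda>j. complex_of_real (f j)) *\<^sub>v x) $ i = f i * x $ i" if "i < n" for i
    using assms that
    by (simp add: mat_diag_def scalar_prod_def atLeast0LessThan if_distribR sum.delta
        cong: if_cong)
       (simp add: if_distrib[of "\<lambda>c. c * _"] sum.delta' cong: if_cong)
  have "(mat_diag n (\<lambda>j. complex_of_real (f j)) *\<^sub>v x) \<bullet>c x
      = (\<Sum>i<n. f i * x $ i * cnj (x $ i))"
    unfolding inner_sum[OF mult_mat_vec_carrier[OF mat_diag_dim assms] assms]
    by (rule sum.cong) (auto simp: entry)
  also have "\<dots> = (\<Sum>i<n. complex_of_real (f i * (cmod (x $ i))\<^sup>2))"
    by (rule sum.cong[OF refl]) (simp only: of_real_mult complex_norm_square mult.assoc)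
  finally show ?thesis
    unfolding re_form_def by (simp only: Re_sum Re_complex_of_real)
qed

lemma re_form_mat_diag_le:
  assumes "x \<in> carrier_vec n" "\<And>i. i < n \<Longrightarrow> f i \<le> c"
  shows "re_form (mat_diag n (\<lambda>j. complex_of_real (f j))) x \<le> c * sq_len x"
  unfolding re_form_mat_diag[OF assms(1)] sq_len_sum[OF assms(1)] sum_distrib_left
  by (intro sum_mono mult_right_mono assms(2)) auto

text \<open>Padding with zeros restricts a form to a diagonal block; in this way the diagonal blocks of a
  matrix with vanishing real form inherit that property.\<close>
lemma re_form_four_block:
  assumes P: "P \<in> carrier_mat k k" and Q: "Q \<in> carrier_mat k m"
    and R: "R \<in> carrier_mat m k" and T: "T \<in> carrier_mat m m"
  shows "a \<in> carrier_vec k \<Longrightarrow> re_form (four_block_mat P Q R T) (a @\<^sub>v 0\<^sub>v m) = re_form P a"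
    and "b \<in> carrier_vec m \<Longrightarrow> re_form (four_block_mat P Q R T) (0\<^sub>v k @\<^sub>v b) = re_form T b"
proof -
  have conj: "conjugate (a @\<^sub>v b) = conjugate a @\<^sub>v conjugate b" for a b :: "complex vec"
    by (rule eq_vecI) auto
  show "re_form (four_block_mat P Q R T) (a @\<^sub>v 0\<^sub>v m) = re_form P a" if a: "a \<in> carrier_vec k"
  proof -
    have "four_block_mat P Q R T *\<^sub>v (a @\<^sub>v 0\<^sub>v m) = P *\<^sub>v a @\<^sub>v R *\<^sub>v a"
      using assms a mult_mat_vec_carrier[OF P a] mult_mat_vec_carrier[OF R a]
      by (simp add: four_block_mat_mult_vec[OF P Q R T] mult_mat_zero_vec[OF P]
          mult_mat_zero_vec[OF Q] mult_mat_zero_vec[OF R] mult_mat_zero_vec[OF T])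
    then show ?thesis
      using a mult_mat_vec_carrier[OF P a] mult_mat_vec_carrier[OF R a]
      by (simp add: re_form_def conj scalar_prod_append[of _ k _ m])
  qed
  show "re_form (four_block_mat P Q R T) (0\<^sub>v k @\<^sub>v b) = re_form T b" if b: "b \<in> carrier_vec m"
  proof -
    have "four_block_mat P Q R T *\<^sub>v (0\<^sub>v k @\<^sub>v b) = Q *\<^sub>v b @\<^sub>v T *\<^sub>v b"
      using assms b mult_mat_vec_carrier[OF Q b] mult_mat_vec_carrier[OF T b]
      by (simp add: four_block_mat_mult_vec[OF P Q R T] mult_mat_zero_vec[OF P]
          mult_mat_zero_vec[OF Q] mult_mat_zero_vec[OF R] mult_mat_zero_vec[OF T])
    then show ?thesis
      using b mult_mat_vec_carrier[OF Q b] mult_mat_vec_carrier[OF T b]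
      by (simp add: re_form_def conj scalar_prod_append[of _ k _ m])
  qed
qed

lemma eigenbasis_matrix:
  fixes H :: "complex mat"
  assumes H: "H \<in> carrier_mat n n"
    and basis: "ordered_orthonormal_eigenbasis n H d u"
    and U: "U = mat_of_cols n (map u [0..<n])"
  shows "U \<in> carrier_mat n n"
    and "mat_adjoint U * U = 1\<^sub>m n"
    and "mat_adjoint U * H * U = mat_diag n (\<lambda>j. complex_of_real (d j))"
proof -
  have u: "u j \<in> carrier_vec n" "H *\<^sub>v u j = complex_of_real (d j) \<cdot>\<^sub>v u j" if "j < n" for j
    using basis H that by (auto simp: ordered_orthonormal_eigenbasis_def eigenvector_def)
  have orth: "u j \<bullet>c u i = (if i = j then 1 else 0)" if "i < n" "j < n" for i j
    using basis that by (auto simp: ordered_orthonormal_eigenbasis_def)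
  show UC: "U \<in> carrier_mat n n"
    unfolding U by (metis diff_zero length_map length_upt mat_of_cols_carrier(1))
  have col: "col U j = u j" if "j < n" for j
    using that u(1)[OF that] by (simp add: U)
  have row: "row (mat_adjoint U) i = conjugate (u i)" if "i < n" for i
    unfolding col[OF that, symmetric] using that UC by (intro eq_vecI) auto
  have inner: "conjugate (u i) \<bullet> u j = (if i = j then 1 else 0)" if "i < n" "j < n" for i j
    using conjugate_vec_sprod_comm[OF u(1)[OF that(2)] u(1)[OF that(1)]] orth[OF that] by simp
  show "mat_adjoint U * U = 1\<^sub>m n"
    using UC by (intro eq_matI) (auto simp: row col inner)
  have "mat_adjoint U * H * U = mat_adjoint U * (H * U)"
    by (rule assoc_mult_mat[OF mat_adjoint_carrier[OF UC] H UC])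
  also have "\<dots> = mat_diag n (\<lambda>j. complex_of_real (d j))"
  proof (rule eq_matI)
    fix i j
    assume "i < dim_row (mat_diag n (\<lambda>j. complex_of_real (d j)))"
      "j < dim_col (mat_diag n (\<lambda>j. complex_of_real (d j)))"
    then have ij: "i < n" "j < n"
      by (auto simp: mat_diag_def)
    have "(mat_adjoint U * (H * U)) $$ (i, j) = conjugate (u i) \<bullet> (H *\<^sub>v u j)"
      using ij UC H by (simp add: row col mult_mat_vec_def)
    also have "\<dots> = d j * (conjugate (u i) \<bullet> u j)"
      using ij u by (simp add: scalar_prod_smult_distrib[of _ n])
    finally show "(mat_adjoint U * (H * U)) $$ (i, j)
        = mat_diag n (\<lambda>j. complex_of_real (d j)) $$ (i, j)"
      using ij by (simp add: inner mat_diag_def)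
  qed (use UC H in \<open>auto simp: mat_diag_def\<close>)
  finally show "mat_adjoint U * H * U = mat_diag n (\<lambda>j. complex_of_real (d j))" .
qed

lemma unitary_conjugate_eigenvector:
  fixes A U :: "complex mat"
  assumes A: "A \<in> carrier_mat n n" and U: "U \<in> carrier_mat n n" "mat_adjoint U * U = 1\<^sub>m n"
    and "eigenvector A v c"
  shows "eigenvector (mat_adjoint U * A * U) (mat_adjoint U *\<^sub>v v) c"
proof -
  have v: "v \<in> carrier_vec n" "v \<noteq> 0\<^sub>v n" "A *\<^sub>v v = c \<cdot>\<^sub>v v"
    using assms by (auto simp: eigenvector_def)
  have U': "mat_adjoint U \<in> carrier_mat n n"
    using U(1) by simp
  have "U * mat_adjoint U = 1\<^sub>m n"
    by (rule mat_mult_left_right_inverse[OF U' U])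
  define x where "x = mat_adjoint U *\<^sub>v v"
  have x: "x \<in> carrier_vec n"
    unfolding x_def by (rule mult_mat_vec_carrier[OF U' v(1)])
  have "U *\<^sub>v x = (U * mat_adjoint U) *\<^sub>v v"
    unfolding x_def by (rule assoc_mult_mat_vec[OF U(1) U' v(1), symmetric])
  then have Ux: "U *\<^sub>v x = v"
    using \<open>U * mat_adjoint U = 1\<^sub>m n\<close> v(1) by simp
  then have "x \<noteq> 0\<^sub>v n"
    using v(2) U(1) by auto
  moreover have "(mat_adjoint U * A * U) *\<^sub>v x = c \<cdot>\<^sub>v x"
  proof -
    have "(mat_adjoint U * A * U) *\<^sub>v x = (mat_adjoint U * A) *\<^sub>v v"
      using assoc_mult_mat_vec[OF mult_carrier_mat[OF U' A] U(1) x] Ux by simp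
    also have "\<dots> = mat_adjoint U *\<^sub>v (c \<cdot>\<^sub>v v)"
      using assoc_mult_mat_vec[OF U' A v(1)] v(3) by simp
    also have "\<dots> = c \<cdot>\<^sub>v x"
      unfolding x_def by (rule mult_mat_vec[OF U' v(1)])
    finally show ?thesis .
  qed
  ultimately show ?thesis
    using x U(1) unfolding eigenvector_def x_def by simp
qed

section \<open>The eigenvalue bound\<close>

theorem theorem2:
  fixes n k :: nat
    and A U Y\<^sub>k V\<^sub>k Yt\<^sub>k W\<^sub>k :: "complex mat"
    and lam :: complex
    and \<delta> :: "nat \<Rightarrow> real"
    and u :: "nat \<Rightarrow> complex vec"
  assumes "n \<ge> 2" and "1 \<le> k" and "k \<le> n - 1"
    and "A \<in> carrier_mat n n"
    and "eigenvalue A lam"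
    and "ordered_orthonormal_eigenbasis n (hermitian_part A) \<delta> u"
    and "U = mat_of_cols n (map u [0..<n])"
    and "Y\<^sub>k \<in> carrier_mat k k"
    and "V\<^sub>k \<in> carrier_mat (n - k) k"
    and "Yt\<^sub>k \<in> carrier_mat (n - k) (n - k)"
    and "mat_adjoint U * skew_hermitian_part A * U
           = four_block_mat Y\<^sub>k (- mat_adjoint V\<^sub>k) V\<^sub>k Yt\<^sub>k"
    and "W\<^sub>k = mat_diag k (\<lambda>j. complex_of_real (\<delta> j)) + Y\<^sub>k - lam \<cdot>\<^sub>m 1\<^sub>m k"
  shows "(cmod (det W\<^sub>k))\<^sup>2 * (Re lam - \<delta> k)
           \<le> (largest_singular_value V\<^sub>k)\<^sup>2 *
              largest_eigenvalue (hermitian_part (det W\<^sub>k \<cdot>\<^sub>m adj_mat (mat_adjoint W\<^sub>k)))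
         \<and> largest_eigenvalue (hermitian_part (det W\<^sub>k \<cdot>\<^sub>m adj_mat (mat_adjoint W\<^sub>k))) \<ge> 0"
proof -
  define m where "m = n - k"
  have n: "n = k + m" and k: "0 < k" and kn: "k < n"
    using assms(1-3) by (auto simp: m_def)
  note A = assms(4)
  note Y = assms(8) and V = assms(9)[folded m_def] and Yt = assms(10)[folded m_def]
  let ?S = "skew_hermitian_part A"
  let ?D = "mat_diag n (\<lambda>j. complex_of_real (\<delta> j))"
  let ?Dk = "mat_diag k (\<lambda>j. complex_of_real (\<delta> j))"
  let ?Dt = "mat_diag m (\<lambda>j. complex_of_real (\<delta> (k + j)))"
  let ?Y = "four_block_mat Y\<^sub>k (- mat_adjoint V\<^sub>k) V\<^sub>k Yt\<^sub>k"
  have mono: "\<delta> j \<le> \<delta> i" if "i \<le> j" "j < n" for i j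
    using assms(6) that unfolding ordered_orthonormal_eigenbasis_def by auto
  note U = eigenbasis_matrix[OF hermitian_part_carrier[OF A] assms(6,7)]
  have S: "?S \<in> carrier_mat n n"
    using A by simp
  have V': "- mat_adjoint V\<^sub>k \<in> carrier_mat k m"
    using mat_adjoint_carrier[OF V] by simp
  have Y_full: "?Y \<in> carrier_mat n n"
    unfolding n by (rule four_block_carrier_mat[OF Y Yt])
  \<comment> \<open>The skew-Hermitian part is invisible to the real part of the form, in each diagonal block too.\<close>
  have skew: "re_form ?Y y = 0" if y: "y \<in> carrier_vec n" for y
    using re_form_congruence[OF S U(1) y]
      re_form_skew_hermitian_part[OF A mult_mat_vec_carrier[OF U(1) y]]
    by (simp add: assms(11))
  have skew_Yk: "re_form Y\<^sub>k a = 0" if a: "a \<in> carrier_vec k" for a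
    using skew[of "a @\<^sub>v 0\<^sub>v m"] re_form_four_block(1)[OF Y V' V Yt a] a by (simp add: n)
  have skew_Yt: "re_form Yt\<^sub>k b = 0" if b: "b \<in> carrier_vec m" for b
    using skew[of "0\<^sub>v k @\<^sub>v b"] re_form_four_block(2)[OF Y V' V Yt b] b by (simp add: n)

  have conjA: "mat_adjoint U * A * U = ?D + ?Y"
  proof -
    have U': "mat_adjoint U \<in> carrier_mat n n"
      using U(1) by simp
    have H: "hermitian_part A \<in> carrier_mat n n"
      using A by simp
    have "mat_adjoint U * A * U = mat_adjoint U * (hermitian_part A + ?S) * U"
      by (simp only: hermitian_plus_skew_hermitian_part[OF A])
    also have "\<dots> = mat_adjoint U * hermitian_part A * U + mat_adjoint U * ?S * U"
      unfolding mult_add_distrib_mat[OF U' H S]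
      by (rule add_mult_distrib_mat[OF mult_carrier_mat[OF U' H] mult_carrier_mat[OF U' S] U(1)])
    finally show ?thesis
      by (simp only: U(3) assms(11))
  qed
  obtain x where x: "x \<in> carrier_vec n" "x \<noteq> 0\<^sub>v n" "(?D + ?Y) *\<^sub>v x = lam \<cdot>\<^sub>v x"
  proof -
    obtain v where "eigenvector A v lam"
      using assms(5) by (auto simp: eigenvalue_def)
    then have "eigenvector (?D + ?Y) (mat_adjoint U *\<^sub>v v) lam"
      using unitary_conjugate_eigenvector[OF A U(1,2)] by (simp only: conjA)
    moreover have "dim_row (?D + ?Y) = n"
      using Y_full by (metis carrier_matD(1) index_add_mat(2))
    ultimately show ?thesis
      using that unfolding eigenvector_def by metis
  qed

  \<comment> \<open>The real part of an eigenvalue lies in the numerical range of the Hermitian part.\<close>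
  have lam_le: "Re lam \<le> \<delta> 0"
  proof -
    have "re_form (?D + ?Y) x = re_form ?D x"
      using re_form_add[OF mat_diag_dim Y_full x(1)] skew[OF x(1)] by simp
    also have "\<dots> \<le> \<delta> 0 * sq_len x"
      by (rule re_form_mat_diag_le[OF x(1)]) (simp add: mono)
    finally have "Re lam * sq_len x \<le> \<delta> 0 * sq_len x"
      using x(1) by (simp add: re_form_def x(3) inner_self[OF x(1)] smult_scalar_prod_distrib[of _ n])
    then show ?thesis
      using sq_len_pos[OF x(1,2)] by simp
  qed

  define L where
    "L = largest_eigenvalue (hermitian_part (det W\<^sub>k \<cdot>\<^sub>m adj_mat (mat_adjoint W\<^sub>k)))"
  have DY: "?Dk + Y\<^sub>k \<in> carrier_mat k k"
    using Y by simp
  have W: "W\<^sub>k \<in> carrier_mat k k"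
    unfolding assms(12) by (rule minus_carrier_mat) simp
  have form_W: "re_form W\<^sub>k y = re_form ?Dk y - Re lam * sq_len y" if "y \<in> carrier_vec k" for y
    unfolding assms(12) re_form_minus_smult_one[OF DY that]
    using re_form_add[OF mat_diag_dim Y that] skew_Yk[OF that] by simp
  have L_nonneg: "L \<ge> 0"
    unfolding L_def
  proof (rule largest_eigenvalue_adjugate_nonneg[OF W])
    let ?e = "unit_vec k 0 :: complex vec"
    show e: "?e \<in> carrier_vec k"
      by simp
    show "?e \<noteq> 0\<^sub>v k"
      using k by (metis index_unit_vec(2) index_zero_vec(1) zero_neq_one)
    have "re_form ?Dk ?e = \<delta> 0" and "sq_len ?e = 1"
      using k unfolding re_form_mat_diag[OF e] sq_len_sum[OF e]
      by (subst sum.remove[of _ 0]; auto)+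
    then show "re_form W\<^sub>k ?e \<ge> 0"
      using form_W[OF e] lam_le by simp
  qed

  \<comment> \<open>The eigenvector equation for \<open>x\<close>, read off block by block.\<close>
  define a where "a = vec_first x k"
  define b where "b = vec_last x m"
  have a: "a \<in> carrier_vec k" and b: "b \<in> carrier_vec m" and xab: "x = a @\<^sub>v b"
    using x(1) by (auto simp: a_def b_def n)
  have nonzero: "a \<noteq> 0\<^sub>v k \<or> b \<noteq> 0\<^sub>v m"
  proof (rule ccontr)
    assume "\<not> ?thesis"
    then have "x = 0\<^sub>v n"
      unfolding xab n by (intro eq_vecI) auto
    then show False
      using x(2) by simp
  qed
  have "?D = four_block_mat ?Dk (0\<^sub>m k m) (0\<^sub>m m k) ?Dt"
    unfolding n by (intro eq_matI) (auto simp: mat_diag_def)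
  then have "?D + ?Y = four_block_mat (?Dk + Y\<^sub>k) (- mat_adjoint V\<^sub>k) V\<^sub>k (?Dt + Yt\<^sub>k)"
    using add_four_block_mat[OF mat_diag_dim zero_carrier_mat zero_carrier_mat mat_diag_dim Y V' V Yt]
      V V' by simp
  moreover have DtYt: "?Dt + Yt\<^sub>k \<in> carrier_mat m m"
    using Yt by simp
  ultimately have "((?Dk + Y\<^sub>k) *\<^sub>v a + (- mat_adjoint V\<^sub>k) *\<^sub>v b) @\<^sub>v (V\<^sub>k *\<^sub>v a + (?Dt + Yt\<^sub>k) *\<^sub>v b)
      = lam \<cdot>\<^sub>v (a @\<^sub>v b)"
    using x(3) four_block_mat_mult_vec[OF DY V' V DtYt a b] by (simp only: xab)
  also have "\<dots> = (lam \<cdot>\<^sub>v a) @\<^sub>v (lam \<cdot>\<^sub>v b)"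
    by (intro eq_vecI) auto
  finally have "(?Dk + Y\<^sub>k) *\<^sub>v a + (- mat_adjoint V\<^sub>k) *\<^sub>v b = lam \<cdot>\<^sub>v a
      \<and> V\<^sub>k *\<^sub>v a + (?Dt + Yt\<^sub>k) *\<^sub>v b = lam \<cdot>\<^sub>v b"
    by (subst (asm) append_vec_eq[of _ k])
      (use a mult_mat_vec_carrier[OF DY a] mult_mat_vec_carrier[OF V' b] in auto)
  then have top_eq: "(?Dk + Y\<^sub>k) *\<^sub>v a + (- mat_adjoint V\<^sub>k) *\<^sub>v b = lam \<cdot>\<^sub>v a"
    and bottom_eq: "V\<^sub>k *\<^sub>v a + (?Dt + Yt\<^sub>k) *\<^sub>v b = lam \<cdot>\<^sub>v b"
    by auto
  define Z where "Z = ?Dt + Yt\<^sub>k - lam \<cdot>\<^sub>m 1\<^sub>m m"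
  have Z: "Z \<in> carrier_mat m m"
    unfolding Z_def by (rule minus_carrier_mat) simp
  have W_vec: "W\<^sub>k *\<^sub>v a = (?Dk + Y\<^sub>k) *\<^sub>v a - lam \<cdot>\<^sub>v a"
    unfolding assms(12) using minus_mult_distrib_mat_vec[OF DY _ a, of "lam \<cdot>\<^sub>m 1\<^sub>m k"] a
    by (simp add: smult_mat_mult_vec[of _ k k])
  have Z_vec: "Z *\<^sub>v b = (?Dt + Yt\<^sub>k) *\<^sub>v b - lam \<cdot>\<^sub>v b"
    unfolding Z_def using minus_mult_distrib_mat_vec[OF DtYt _ b, of "lam \<cdot>\<^sub>m 1\<^sub>m m"] b
    by (simp add: smult_mat_mult_vec[of _ m m])
  have top: "W\<^sub>k *\<^sub>v a = mat_adjoint V\<^sub>k *\<^sub>v b"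
  proof -
    have Vb: "mat_adjoint V\<^sub>k *\<^sub>v b \<in> carrier_vec k"
      by (rule mult_mat_vec_carrier[OF mat_adjoint_carrier[OF V] b])
    have "(- mat_adjoint V\<^sub>k) *\<^sub>v b = - (mat_adjoint V\<^sub>k *\<^sub>v b)"
      using V b by (intro uminus_mult_mat_vec) simp
    then show ?thesis
      unfolding W_vec top_eq[symmetric]
      using mult_mat_vec_carrier[OF DY a] Vb by (intro eq_vecI) auto
  qed
  have cancel: "p + (q - (p + q)) = 0\<^sub>v m"
    if "p \<in> carrier_vec m" "q \<in> carrier_vec m" for p q :: "complex vec"
    using that by (intro eq_vecI) auto
  have bottom: "V\<^sub>k *\<^sub>v a + Z *\<^sub>v b = 0\<^sub>v m"
    unfolding Z_vec bottom_eq[symmetric]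
    using cancel[OF mult_mat_vec_carrier[OF V a] mult_mat_vec_carrier[OF DtYt b]] .
  have "re_form ?Dt b \<le> \<delta> k * sq_len b"
    by (rule re_form_mat_diag_le[OF b]) (rule mono, auto simp: n)
  then have Z_bound: "re_form Z b \<le> - (Re lam - \<delta> k) * sq_len b"
    unfolding Z_def re_form_minus_smult_one[OF DtYt b]
    using re_form_add[OF mat_diag_dim Yt b] skew_Yt[OF b] by (simp add: algebra_simps)
  have "(cmod (det W\<^sub>k))\<^sup>2 * (Re lam - \<delta> k) \<le> (largest_singular_value V\<^sub>k)\<^sup>2 * L"
    by (rule block_kernel_bound[OF W V Z a b nonzero top bottom Z_bound L_def L_nonneg])
  then show ?thesis
    using L_nonneg by (simp add: L_def)
qed

end
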